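(* Let $(\mathbb{X},\perp)$ be a classical $\perp$-restriction category. There is a bijective correspondence between Kleene wands on $\mathbb{X}$ and Kleene upper-stars on $\mathbb{X}$. Therefore, a classical $\perp$-itegory is precisely a classical $\perp$-restriction category with a Kleene upper-star.
   Context: Composition is diagrammatic: $fg$ means first $f$, then $g$. A restriction category is a category with an operator sending each $f:A\to B$ to $\overline{f}:A\to A$ such that $\overline{f}f=f$; $\overline{f}\,\overline{g}=\overline{g}\,\overline{f}$ and $\overline{\overline{g}f}=\overline{g}\,\overline{f}$ for $f:A\to B$, $g:A\to C$; and $f\overline{g}=\overline{fg}f$ for $f:A\to B$, $g:B\to C$. For parallel $f,g$: $f\le g$ iff $\overline{f}g=f$ (a partial order). A restriction idempotent is a map $e:A\to A$ with $\overline{e}=e$; then $e\le 1_A$. Restriction zeroes: maps $0:A\to B$ with $f0=0=0f$ and $\overline{0}=0$. An interference relation $\perp$ on a restriction category with restriction zeroes is a family of relations between maps with the same domain ($f:A\to B$, $g:A\to C$) such that: $1_A\perp 0$; $f\perp g\Rightarrow g\perp f$; $f\perp f\Rightarrow f=0$; $f'\perp g'$, $f\le f'$, $g\le g'$ imply $f\perp g$; $f\perp g\Rightarrow hfk\perp hgk'$ for all composable $h,k,k'$; $f\perp g\Rightarrow\overline{f}\perp\overline{g}$. A $\perp$-restriction category (interference restriction category) is a restriction category with restriction zeroes and a chosen interference relation $\perp$. It has all binary $\perp$-joins if any parallel $f,g:A\to B$ with $f\perp g$ have a least upper bound $f\sqcup g$ with respect to $\le$, and $h(f\sqcup g)=hf\sqcup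 hg$ for all $h:A'\to A$. Given parallel $f\le g$, the $\perp$-relative complement of $f$ in $g$ is a (necessarily unique) map $g\backslash f$ with $g\backslash f\perp f$ and $(g\backslash f)\sqcup f=g$. A classical $\perp$-restriction category is a $\perp$-restriction category with all binary $\perp$-joins in which all $\perp$-relative complements exist. For a restriction idempotent $e:A\to A$ write $e^c:=1_A\backslash e$. A Kleene wand $\circledast$ on a $\perp$-restriction category with all binary $\perp$-joins assigns to each $f:X\to X$, $g:X\to A$ with $f\perp g$ a map $f\circledast g:X\to A$ such that: (1) if $f \perp g$, then $g\sqcup f(f\circledast g)=f\circledast g$; (2) $(f\circledast g)h=f\circledast gh$ for $f\perp g$, $h:A\to B$; (3) for $f:X\to Y$, $g:X\to A$, $k:Y\to X$ with $f\perp g$: $kf\circledast kg=k(fk\circledast g)$; (4) for $f,f':X\to X$, $g:X\to A$ with $f\perp f'$ and $f\sqcup f'\perp g$: $(f\circledast f')\perp(f\circledast g)$ and $(f\sqcup f')\circledast g=(f\circledast f')\circledast(f\circledast g)$. A $\perp$-itegory is a $\perp$-restriction category with all binary $\perp$-joins together with a Kleene wand; it is classical if the underlying $\perp$-restriction category is classical. A Kleene upper-star on a classical $\perp$-restriction category assigns to each endomorphism $f:X\to X$ an endomorphism $f^\star:X\to X$ such that: ($\star$1) $\overline{f}^{\,c}\sqcup ff^\star=f^\star$; ($\star$2) for $f:X\to Y$ and $h:Y\to X$: $(hf)^\star h=h(fh)^\star\,\overline{f}^{\,c}$; ($\star$3) for $f,g:X\to X$ with $f\perp g$: $(f\sqcup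 g)^\star=(f^\star g)^\star f^\star$. *)

theory Defs
  imports Main "HOL-Library.FuncSet"
begin

text \<open>
  Categories are given by carrier sets of objects and arrows.  Composition is diagrammatic:
  \<open>f \<cdot> g\<close> is first \<open>f\<close>, then \<open>g\<close>, and is constrained only for \<open>cod f = dom g\<close>.
\<close>

record ('o, 'a) cat =
  Obj :: "'o set"
  Arr :: "'a set"
  Dom :: "'a \<Rightarrow> 'o"
  Cod :: "'a \<Rightarrow> 'o"
  ident :: "'o \<Rightarrow> 'a"  ("\<iota>\<index>")
  comp :: "'a \<Rightarrow> 'a \<Rightarrow> 'a"  (infixl "\<cdot>\<index>" 70)

definition hom :: "('o, 'a, 'm) cat_scheme \<Rightarrow> 'o \<Rightarrow> 'o \<Rightarrow> 'a set" where
  "hom X A B = {f \<in> Arr X. Dom X f = A \<and> Cod X f = B}"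

definition endos :: "('o, 'a, 'm) cat_scheme \<Rightarrow> 'a set" where
  "endos X = {f \<in> Arr X. Dom X f = Cod X f}"

locale category =
  fixes X :: "('o, 'a, 'm) cat_scheme" (structure)
  assumes dom_obj: "f \<in> Arr X \<Longrightarrow> Dom X f \<in> Obj X"
    and cod_obj: "f \<in> Arr X \<Longrightarrow> Cod X f \<in> Obj X"
    and ident_hom: "A \<in> Obj X \<Longrightarrow> \<iota> A \<in> hom X A A"
    and comp_hom: "\<lbrakk>f \<in> hom X A B; g \<in> hom X B C\<rbrakk> \<Longrightarrow> f \<cdot> g \<in> hom X A C"
    and ident_left: "f \<in> hom X A B \<Longrightarrow> \<iota> A \<cdot> f = f"
    and ident_right: "f \<in> hom X A B \<Longrightarrow> f \<cdot> \<iota> B = f"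
    and comp_assoc: "\<lbrakk>f \<in> hom X A B; g \<in> hom X B C; h \<in> hom X C D\<rbrakk>
      \<Longrightarrow> (f \<cdot> g) \<cdot> h = f \<cdot> (g \<cdot> h)"

record ('o, 'a) restriction_cat = "('o, 'a) cat" +
  restr :: "'a \<Rightarrow> 'a"  ("\<rho>\<index>")

locale restriction_category = category X
  for X :: "('o, 'a, 'm) restriction_cat_scheme" (structure) +
  assumes restr_hom: "f \<in> hom X A B \<Longrightarrow> \<rho> f \<in> hom X A A"
    and restr_comp_self: "f \<in> hom X A B \<Longrightarrow> \<rho> f \<cdot> f = f"
    and restr_commute: "\<lbrakk>f \<in> hom X A B; g \<in> hom X A C\<rbrakk> \<Longrightarrow> \<rho> f \<cdot> \<rho> g = \<rho> g \<cdot> \<rho> f"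
    and restr_restr_comp: "\<lbrakk>f \<in> hom X A B; g \<in> hom X A C\<rbrakk> \<Longrightarrow> \<rho> (\<rho> g \<cdot> f) = \<rho> g \<cdot> \<rho> f"
    and comp_restr: "\<lbrakk>f \<in> hom X A B; g \<in> hom X B C\<rbrakk> \<Longrightarrow> f \<cdot> \<rho> g = \<rho> (f \<cdot> g) \<cdot> f"

definition parallel :: "('o, 'a, 'm) cat_scheme \<Rightarrow> 'a \<Rightarrow> 'a \<Rightarrow> bool" where
  "parallel X f g \<longleftrightarrow>
    f \<in> Arr X \<and> g \<in> Arr X \<and> Dom X f = Dom X g \<and> Cod X f = Cod X g"

definition leq :: "('o, 'a, 'm) restriction_cat_scheme \<Rightarrow> 'a \<Rightarrow> 'a \<Rightarrow> bool"  (infix "\<preceq>\<index>" 50) where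
  "f \<preceq>\<^bsub>X\<^esub> g \<longleftrightarrow> parallel X f g \<and> \<rho>\<^bsub>X\<^esub> f \<cdot>\<^bsub>X\<^esub> g = f"

definition is_join :: "('o, 'a, 'm) restriction_cat_scheme \<Rightarrow> 'a \<Rightarrow> 'a \<Rightarrow> 'a \<Rightarrow> bool" where
  "is_join X f g j \<longleftrightarrow>
    f \<preceq>\<^bsub>X\<^esub> j \<and> g \<preceq>\<^bsub>X\<^esub> j \<and> (\<forall>u. f \<preceq>\<^bsub>X\<^esub> u \<and> g \<preceq>\<^bsub>X\<^esub> u \<longrightarrow> j \<preceq>\<^bsub>X\<^esub> u)"

definition join :: "('o, 'a, 'm) restriction_cat_scheme \<Rightarrow> 'a \<Rightarrow> 'a \<Rightarrow> 'a"  (infixl "\<squnion>\<index>" 65) where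
  "f \<squnion>\<^bsub>X\<^esub> g = (THE j. is_join X f g j)"

record ('o, 'a) perp_cat = "('o, 'a) restriction_cat" +
  zero_map :: "'o \<Rightarrow> 'o \<Rightarrow> 'a"  ("\<zero>\<index>")
  interf :: "'a \<Rightarrow> 'a \<Rightarrow> bool"  (infix "\<perp>\<index>" 50)

locale perp_restriction_category = restriction_category X
  for X :: "('o, 'a, 'm) perp_cat_scheme" (structure) +
  assumes zero_hom: "\<lbrakk>A \<in> Obj X; B \<in> Obj X\<rbrakk> \<Longrightarrow> \<zero> A B \<in> hom X A B"
    and comp_zero: "\<lbrakk>f \<in> hom X A B; C \<in> Obj X\<rbrakk> \<Longrightarrow> f \<cdot> \<zero> B C = \<zero> A C"
    and zero_comp: "\<lbrakk>f \<in> hom X B C; A \<in> Obj X\<rbrakk> \<Longrightarrow> \<zero> A B \<cdot> f = \<zero> A C"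
    and restr_zero: "\<lbrakk>A \<in> Obj X; B \<in> Obj X\<rbrakk> \<Longrightarrow> \<rho> (\<zero> A B) = \<zero> A A"
    and interf_dom: "f \<perp> g \<Longrightarrow> f \<in> Arr X \<and> g \<in> Arr X \<and> Dom X f = Dom X g"
    and interf_ident_zero: "\<lbrakk>A \<in> Obj X; B \<in> Obj X\<rbrakk> \<Longrightarrow> \<iota> A \<perp> \<zero> A B"
    and interf_sym: "f \<perp> g \<Longrightarrow> g \<perp> f"
    and interf_self: "\<lbrakk>f \<in> hom X A B; f \<perp> f\<rbrakk> \<Longrightarrow> f = \<zero> A B"
    and interf_down: "\<lbrakk>f' \<perp> g'; f \<preceq> f'; g \<preceq> g'\<rbrakk> \<Longrightarrow> f \<perp> g"
    and interf_comp: "\<lbrakk>f \<perp> g; h \<in> hom X A' A; f \<in> hom X A B; g \<in> hom X A C;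
        k \<in> hom X B B'; k' \<in> hom X C C'\<rbrakk> \<Longrightarrow> h \<cdot> f \<cdot> k \<perp> h \<cdot> g \<cdot> k'"
    and interf_restr: "f \<perp> g \<Longrightarrow> \<rho> f \<perp> \<rho> g"

locale perp_join_restriction_category = perp_restriction_category X
  for X :: "('o, 'a, 'm) perp_cat_scheme" (structure) +
  assumes join_exists: "\<lbrakk>parallel X f g; f \<perp> g\<rbrakk> \<Longrightarrow> \<exists>j. is_join X f g j"
    and comp_join: "\<lbrakk>h \<in> hom X A' A; f \<in> hom X A B; g \<in> hom X A B; f \<perp> g\<rbrakk>
      \<Longrightarrow> h \<cdot> (f \<squnion> g) = h \<cdot> f \<squnion> h \<cdot> g"

definition is_rel_compl :: "('o, 'a, 'm) perp_cat_scheme \<Rightarrow> 'a \<Rightarrow> 'a \<Rightarrow> 'a \<Rightarrow> bool" where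
  "is_rel_compl X g f r \<longleftrightarrow> parallel X r f \<and> r \<perp>\<^bsub>X\<^esub> f \<and> r \<squnion>\<^bsub>X\<^esub> f = g"

definition rel_compl :: "('o, 'a, 'm) perp_cat_scheme \<Rightarrow> 'a \<Rightarrow> 'a \<Rightarrow> 'a" where
  "rel_compl X g f = (THE r. is_rel_compl X g f r)"

definition compl :: "('o, 'a, 'm) perp_cat_scheme \<Rightarrow> 'a \<Rightarrow> 'a" where
  "compl X e = rel_compl X (\<iota>\<^bsub>X\<^esub> (Dom X e)) e"

locale classical_perp_restriction_category = perp_join_restriction_category X
  for X :: "('o, 'a, 'm) perp_cat_scheme" (structure) +
  assumes rel_compl_exists: "f \<preceq> g \<Longrightarrow> \<exists>r. is_rel_compl X g f r"

text \<open>
  A Kleene wand is a function on the pairs in \<open>wand_dom\<close> and a Kleene upper-star is a function on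
  \<open>endos\<close>.  As total HOL functions they are required to be \<open>undefined\<close> elsewhere, so that equality
  of HOL functions is equality of wands (of upper-stars).
\<close>

definition wand_dom :: "('o, 'a, 'm) perp_cat_scheme \<Rightarrow> ('a \<times> 'a) set" where
  "wand_dom X = {(f, g). f \<in> endos X \<and> g \<in> Arr X \<and> Dom X f = Dom X g \<and> f \<perp>\<^bsub>X\<^esub> g}"

locale kleene_wand = perp_join_restriction_category X
  for X :: "('o, 'a, 'm) perp_cat_scheme" (structure) +
  fixes wand :: "'a \<Rightarrow> 'a \<Rightarrow> 'a"  (infixr "\<circledast>" 68)
  assumes wand_extensional: "case_prod wand \<in> extensional (wand_dom X)"
    and wand_hom: "\<lbrakk>f \<in> hom X S S; g \<in> hom X S A; f \<perp> g\<rbrakk> \<Longrightarrow> f \<circledast> g \<in> hom X S A"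
    and wand_unfold: "\<lbrakk>f \<in> hom X S S; g \<in> hom X S A; f \<perp> g\<rbrakk>
      \<Longrightarrow> g \<squnion> f \<cdot> (f \<circledast> g) = f \<circledast> g"
    and wand_comp: "\<lbrakk>f \<in> hom X S S; g \<in> hom X S A; f \<perp> g; h \<in> hom X A B\<rbrakk>
      \<Longrightarrow> (f \<circledast> g) \<cdot> h = f \<circledast> (g \<cdot> h)"
    and wand_slide: "\<lbrakk>f \<in> hom X S T; g \<in> hom X S A; k \<in> hom X T S; f \<perp> g\<rbrakk>
      \<Longrightarrow> (k \<cdot> f) \<circledast> (k \<cdot> g) = k \<cdot> ((f \<cdot> k) \<circledast> g)"
    and wand_join_interf: "\<lbrakk>f \<in> hom X S S; f' \<in> hom X S S; g \<in> hom X S A; f \<perp> f'; f \<squnion> f' \<perp> g\<rbrakk>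
      \<Longrightarrow> (f \<circledast> f') \<perp> (f \<circledast> g)"
    and wand_join: "\<lbrakk>f \<in> hom X S S; f' \<in> hom X S S; g \<in> hom X S A; f \<perp> f'; f \<squnion> f' \<perp> g\<rbrakk>
      \<Longrightarrow> (f \<squnion> f') \<circledast> g = (f \<circledast> f') \<circledast> (f \<circledast> g)"

text \<open>
  A \<open>\<perp>\<close>-itegory is a pair \<open>(X, wand)\<close> satisfying \<open>kleene_wand\<close>.
\<close>

locale classical_perp_itegory =
  classical_perp_restriction_category X + kleene_wand X wand
  for X :: "('o, 'a, 'm) perp_cat_scheme" (structure)
    and wand :: "'a \<Rightarrow> 'a \<Rightarrow> 'a"

locale kleene_upper_star = classical_perp_restriction_category X
  for X :: "('o, 'a, 'm) perp_cat_scheme" (structure) +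
  fixes star :: "'a \<Rightarrow> 'a"
  assumes star_extensional: "star \<in> extensional (endos X)"
    and star_hom: "f \<in> hom X S S \<Longrightarrow> star f \<in> hom X S S"
    and star_unfold: "f \<in> hom X S S \<Longrightarrow> compl X (\<rho> f) \<squnion> f \<cdot> star f = star f"
    and star_slide: "\<lbrakk>f \<in> hom X S T; h \<in> hom X T S\<rbrakk>
      \<Longrightarrow> star (h \<cdot> f) \<cdot> h = h \<cdot> star (f \<cdot> h) \<cdot> compl X (\<rho> f)"
    and star_join: "\<lbrakk>f \<in> hom X S S; g \<in> hom X S S; f \<perp> g\<rbrakk>
      \<Longrightarrow> star (f \<squnion> g) = star (star f \<cdot> g) \<cdot> star f"

definition star_of_wand ::
    "('o, 'a, 'm) perp_cat_scheme \<Rightarrow> ('a \<Rightarrow> 'a \<Rightarrow> 'a) \<Rightarrow> 'a \<Rightarrow> 'a" where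
  "star_of_wand X w = (\<lambda>f \<in> endos X. w f (compl X (\<rho>\<^bsub>X\<^esub> f)))"

definition wand_of_star ::
    "('o, 'a, 'm) perp_cat_scheme \<Rightarrow> ('a \<Rightarrow> 'a) \<Rightarrow> 'a \<Rightarrow> 'a \<Rightarrow> 'a" where
  "wand_of_star X s = curry (\<lambda>(f, g) \<in> wand_dom X. s f \<cdot>\<^bsub>X\<^esub> g)"

end

theory Submission
  imports Defs
begin

text \<open>
  The two translations are \<open>f\<^sup>\<star> = f \<circledast> (\<rho> f)\<^sup>c\<close> and \<open>f \<circledast> g = f\<^sup>\<star> g\<close>.  They are
  mutually inverse because \<open>f \<perp> g\<close> forces \<open>(\<rho> f)\<^sup>c g = g\<close>, and because the slide law with
  \<open>h = 1\<close> gives \<open>f\<^sup>\<star> (\<rho> f)\<^sup>c = f\<^sup>\<star>\<close>.  The axioms then correspond one by one.  The two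
  less immediate points are that composition distributes over \<open>\<perp>\<close>-joins on the right as well,
  and that \<open>(f\<^sup>\<star> g)\<^sup>\<star> f\<^sup>\<star>\<close> absorbs \<open>(\<rho> (f \<squnion> g))\<^sup>c\<close> because it absorbs both
  \<open>(\<rho> f)\<^sup>c\<close> and \<open>(\<rho> g)\<^sup>c\<close>.
\<close>

section \<open>Typing by hom-sets\<close>

lemma hom_parallel: "\<lbrakk>f \<in> hom X A B; g \<in> hom X A B\<rbrakk> \<Longrightarrow> parallel X f g"
  by (simp add: hom_def parallel_def)

context category
begin

lemma hom_dom_obj: "f \<in> hom X A B \<Longrightarrow> A \<in> Obj X"
  using dom_obj by (auto simp: hom_def)

lemma hom_cod_obj: "f \<in> hom X A B \<Longrightarrow> B \<in> Obj X"
  using cod_obj by (auto simp: hom_def)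

end

section \<open>The restriction order\<close>

context restriction_category
begin

lemma restr_ident:
  assumes "A \<in> Obj X"
  shows "\<rho> (\<iota> A) = \<iota> A"
  using ident_hom[OF assms] by (metis ident_right restr_comp_self restr_hom)

lemma restr_restr:
  assumes "f \<in> hom X A B"
  shows "\<rho> (\<rho> f) = \<rho> f"
  using restr_restr_comp[OF ident_hom assms] assms
  by (metis hom_dom_obj ident_right restr_hom restr_ident)

lemma restr_idem:
  assumes "f \<in> hom X A B"
  shows "\<rho> f \<cdot> \<rho> f = \<rho> f"
  using restr_restr_comp[OF assms assms] restr_comp_self[OF assms] by simp

lemma leq_hom1: "\<lbrakk>f \<preceq> g; g \<in> hom X A B\<rbrakk> \<Longrightarrow> f \<in> hom X A B"
  by (simp add: leq_def parallel_def hom_def)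

lemma leq_hom2: "\<lbrakk>f \<preceq> g; f \<in> hom X A B\<rbrakk> \<Longrightarrow> g \<in> hom X A B"
  by (simp add: leq_def parallel_def hom_def)

lemma leq_homE:
  assumes "f \<preceq> g"
  obtains A B where "f \<in> hom X A B" "g \<in> hom X A B" "\<rho> f \<cdot> g = f"
  using assms by (auto simp: leq_def parallel_def hom_def)

lemma leqI: "\<lbrakk>f \<in> hom X A B; g \<in> hom X A B; \<rho> f \<cdot> g = f\<rbrakk> \<Longrightarrow> f \<preceq> g"
  by (simp add: leq_def hom_parallel)

lemma leq_refl: "f \<in> hom X A B \<Longrightarrow> f \<preceq> f"
  by (simp add: leqI restr_comp_self)

lemma leq_antisym:
  assumes "f \<preceq> g" "g \<preceq> f"
  shows "f = g"
proof -
  obtain A B where f: "f \<in> hom X A B" and g: "g \<in> hom X A B" and fg: "\<rho> f \<cdot> g = f"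
    using assms(1) by (rule leq_homE)
  have gf: "\<rho> g \<cdot> f = g" using assms(2) by (simp add: leq_def)
  have rf: "\<rho> f \<in> hom X A A" and rg: "\<rho> g \<in> hom X A A" using f g restr_hom by auto
  have "f = \<rho> f \<cdot> (\<rho> g \<cdot> f)" by (simp add: fg gf)
  also have "\<dots> = \<rho> g \<cdot> (\<rho> f \<cdot> f)"
    using comp_assoc[OF rf rg f] comp_assoc[OF rg rf f] restr_commute[OF f g] by simp
  also have "\<dots> = g" by (simp add: restr_comp_self[OF f] gf)
  finally show ?thesis .
qed

lemma leq_trans:
  assumes "f \<preceq> g" "g \<preceq> h"
  shows "f \<preceq> h"
proof -
  obtain A B where f: "f \<in> hom X A B" and g: "g \<in> hom X A B" and fg: "\<rho> f \<cdot> g = f"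
    using assms(1) by (rule leq_homE)
  have h: "h \<in> hom X A B" using leq_hom2[OF assms(2) g] .
  have gh: "\<rho> g \<cdot> h = g" using assms(2) by (simp add: leq_def)
  \<comment> \<open>Taking restrictions on both sides of
    \<open>\<rho> f \<cdot> g = f\<close>.\<close>
  have rf: "\<rho> f = \<rho> f \<cdot> \<rho> g" using restr_restr_comp[OF g f] fg by simp
  have "\<rho> f \<cdot> h = \<rho> f \<cdot> \<rho> g \<cdot> h" using rf by simp
  also have "\<dots> = f" using comp_assoc[OF restr_hom[OF f] restr_hom[OF g] h] gh fg by simp
  finally show ?thesis using leqI[OF f h] by simp
qed

lemma restr_comp_leq:
  assumes "e \<in> hom X A C" "g \<in> hom X A B"
  shows "\<rho> e \<cdot> g \<preceq> g"
proof (rule leqI)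
  show "\<rho> e \<cdot> g \<in> hom X A B" using assms by (blast intro: comp_hom restr_hom)
  show "g \<in> hom X A B" by fact
  show "\<rho> (\<rho> e \<cdot> g) \<cdot> g = \<rho> e \<cdot> g"
    using restr_restr_comp[OF assms(2,1)] comp_assoc[OF restr_hom restr_hom assms(2), OF assms]
      restr_comp_self[OF assms(2)] by simp
qed

text \<open>\<open>f \<cdot> k\<close> is \<open>g \<cdot> k\<close> restricted along
  \<open>\<rho> f\<close>, so \<open>restr_comp_leq\<close> applies and
  \<open>\<rho> (f \<cdot> k)\<close> need not be computed.\<close>

lemma comp_mono_right:
  assumes "f \<preceq> g" "f \<in> hom X A B" "k \<in> hom X B C"
  shows "f \<cdot> k \<preceq> g \<cdot> k"
proof -
  have g: "g \<in> hom X A B" using leq_hom2 assms by blast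
  have "f \<cdot> k = \<rho> f \<cdot> (g \<cdot> k)"
    using comp_assoc[OF restr_hom[OF assms(2)] g assms(3)] assms(1) by (simp add: leq_def)
  then show ?thesis using restr_comp_leq[OF assms(2) comp_hom[OF g assms(3)]] by simp
qed

lemma comp_mono_left:
  assumes "f \<preceq> g" "f \<in> hom X A B" "h \<in> hom X C A"
  shows "h \<cdot> f \<preceq> h \<cdot> g"
proof -
  have g: "g \<in> hom X A B" using leq_hom2 assms by blast
  have hf: "h \<cdot> f \<in> hom X C B" using comp_hom assms by blast
  have "\<rho> (h \<cdot> f) \<cdot> (h \<cdot> g) = \<rho> (h \<cdot> f) \<cdot> h \<cdot> g"
    using comp_assoc[OF restr_hom[OF hf] assms(3) g] by simp
  also have "\<dots> = h \<cdot> \<rho> f \<cdot> g" using comp_restr[OF assms(3,2)] by simp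
  also have "\<dots> = h \<cdot> f"
    using comp_assoc[OF assms(3) restr_hom[OF assms(2)] g] assms(1) by (simp add: leq_def)
  finally show ?thesis using leqI[OF hf comp_hom[OF assms(3) g]] by simp
qed

lemma restr_mono:
  assumes "f \<preceq> g"
  shows "\<rho> f \<preceq> \<rho> g"
proof -
  obtain A B where f: "f \<in> hom X A B" and g: "g \<in> hom X A B" and fg: "\<rho> f \<cdot> g = f"
    using assms by (rule leq_homE)
  have "\<rho> (\<rho> f) \<cdot> \<rho> g = \<rho> f"
    using restr_restr[OF f] restr_restr_comp[OF g f] fg by simp
  then show ?thesis using leqI restr_hom f g by blast
qed

text \<open>Below an identity the order equation reads
  \<open>\<rho> e \<cdot> \<iota> A = e\<close>. This is how complements turn out to be restriction
  idempotents.\<close>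

lemma leq_ident_restr:
  assumes "e \<preceq> \<iota> A" "A \<in> Obj X"
  shows "\<rho> e = e"
  using assms by (metis ident_hom ident_right leq_def leq_hom1 restr_hom)

lemma is_join_unique: "\<lbrakk>is_join X f g j; is_join X f g j'\<rbrakk> \<Longrightarrow> j = j'"
  unfolding is_join_def by (blast intro: leq_antisym)

lemma join_eqI: "is_join X f g j \<Longrightarrow> f \<squnion> g = j"
  unfolding join_def by (blast intro: is_join_unique)

text \<open>\<open>is_join\<close> is symmetric in its two summands, so both sides are the same
  definite description, even for pairs that have no join.\<close>

lemma join_commute: "f \<squnion> g = g \<squnion> f"
  unfolding join_def is_join_def by meson

end

section \<open>Zeroes and interference\<close>

context perp_restriction_category
begin

lemma zero_leq:
  assumes "f \<in> hom X A B"
  shows "\<zero> A B \<preceq> f"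
proof -
  have A: "A \<in> Obj X" and B: "B \<in> Obj X" using assms hom_dom_obj hom_cod_obj by auto
  show ?thesis
    using leqI[OF zero_hom[OF A B] assms] restr_zero[OF A B] zero_comp[OF assms A] by simp
qed

lemma join_zero_left: "f \<in> hom X A B \<Longrightarrow> \<zero> A B \<squnion> f = f"
  by (intro join_eqI) (simp add: is_join_def zero_leq leq_refl)

lemma interf_comp_right:
  assumes "f \<perp> g" "f \<in> hom X A B" "g \<in> hom X A C" "k \<in> hom X B B'" "k' \<in> hom X C C'"
  shows "f \<cdot> k \<perp> g \<cdot> k'"
  using interf_comp[OF assms(1) ident_hom assms(2-5)] hom_dom_obj[OF assms(2)]
    ident_left[OF assms(2)] ident_left[OF assms(3)] by simp

lemma interf_comp_left:
  assumes "f \<perp> g" "h \<in> hom X A' A" "f \<in> hom X A B" "g \<in> hom X A C"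
  shows "h \<cdot> f \<perp> h \<cdot> g"
proof -
  have "B \<in> Obj X" "C \<in> Obj X" using assms hom_cod_obj by auto
  then show ?thesis
    using interf_comp[OF assms ident_hom ident_hom]
      ident_right[OF comp_hom[OF assms(2,3)]] ident_right[OF comp_hom[OF assms(2,4)]] by simp
qed

text \<open>\<open>\<rho> f \<cdot> \<rho> g\<close> lies below both \<open>\<rho> f\<close> and
  \<open>\<rho> g\<close>, which interfere. Hence it interferes with itself and is zero, and
  composing with \<open>g\<close> gives the claim.\<close>

lemma interf_restr_comp_zero:
  assumes "f \<perp> g" "f \<in> hom X A B" "g \<in> hom X A C"
  shows "\<rho> f \<cdot> g = \<zero> A C"
proof -
  have A: "A \<in> Obj X" using assms hom_dom_obj by auto
  have rf: "\<rho> f \<in> hom X A A" and rg: "\<rho> g \<in> hom X A A" using assms restr_hom by auto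
  have "\<rho> f \<cdot> \<rho> g \<preceq> \<rho> g" using restr_comp_leq[OF assms(2) rg] .
  moreover have "\<rho> f \<cdot> \<rho> g \<preceq> \<rho> f"
    using restr_comp_leq[OF assms(3) rf] restr_commute[OF assms(2,3)] by simp
  ultimately have "\<rho> f \<cdot> \<rho> g \<perp> \<rho> f \<cdot> \<rho> g"
    using interf_down interf_restr[OF assms(1)] by blast
  then have "\<rho> f \<cdot> \<rho> g = \<zero> A A" using interf_self comp_hom[OF rf rg] by blast
  then show ?thesis
    using comp_assoc[OF rf rg assms(3)] restr_comp_self[OF assms(3)] zero_comp[OF assms(3) A]
    by simp
qed

end

section \<open>Joins, right distributivity and uniqueness of relative complements\<close>

context perp_join_restriction_category
begin

lemma is_join_join:
  assumes "f \<in> hom X A B" "g \<in> hom X A B" "f \<perp> g"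
  shows "is_join X f g (f \<squnion> g)"
  using join_exists[OF hom_parallel[OF assms(1,2)] assms(3)] join_eqI by blast

lemma join_upper1: "\<lbrakk>f \<in> hom X A B; g \<in> hom X A B; f \<perp> g\<rbrakk> \<Longrightarrow> f \<preceq> f \<squnion> g"
  using is_join_join by (auto simp: is_join_def)

lemma join_upper2: "\<lbrakk>f \<in> hom X A B; g \<in> hom X A B; f \<perp> g\<rbrakk> \<Longrightarrow> g \<preceq> f \<squnion> g"
  using is_join_join by (auto simp: is_join_def)

lemma join_least:
  "\<lbrakk>f \<in> hom X A B; g \<in> hom X A B; f \<perp> g; f \<preceq> u; g \<preceq> u\<rbrakk> \<Longrightarrow> f \<squnion> g \<preceq> u"
  using is_join_join by (auto simp: is_join_def)

lemma join_hom: "\<lbrakk>f \<in> hom X A B; g \<in> hom X A B; f \<perp> g\<rbrakk> \<Longrightarrow> f \<squnion> g \<in> hom X A B"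
  using join_upper1 leq_hom2 by blast

text \<open>
  Only distributivity on the left is assumed.  Writing \<open>j = f \<squnion> g\<close> and \<open>u = f k \<squnion> g k\<close>, it gives
  \<open>j (\<rho> k) = \<rho> (j k) (f \<squnion> g) = f (\<rho> k) \<squnion> g (\<rho> k) \<le> (\<rho> u) j\<close>, whence \<open>j k \<le> (\<rho> u) j k = u\<close>.
\<close>

lemma join_comp:
  assumes f: "f \<in> hom X A B" and g: "g \<in> hom X A B" and fg: "f \<perp> g" and k: "k \<in> hom X B C"
  shows "(f \<squnion> g) \<cdot> k = f \<cdot> k \<squnion> g \<cdot> k"
proof -
  define j where "j = f \<squnion> g"
  define u where "u = f \<cdot> k \<squnion> g \<cdot> k"
  have j: "j \<in> hom X A B" and fj: "f \<preceq> j" and gj: "g \<preceq> j"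
    unfolding j_def using join_hom join_upper1 join_upper2 f g fg by auto
  have fk: "f \<cdot> k \<in> hom X A C" and gk: "g \<cdot> k \<in> hom X A C" and jk: "j \<cdot> k \<in> hom X A C"
    using f g j k comp_hom by auto
  have fgk: "f \<cdot> k \<perp> g \<cdot> k" using interf_comp_right[OF fg f g k k] .
  have u: "u \<in> hom X A C" and fku: "f \<cdot> k \<preceq> u" and gku: "g \<cdot> k \<preceq> u"
    unfolding u_def using join_hom join_upper1 join_upper2 fk gk fgk by auto
  have ujk: "u \<preceq> j \<cdot> k"
    unfolding u_def using join_least[OF fk gk fgk] comp_mono_right[OF fj f k]
      comp_mono_right[OF gj g k] by blast
  have ru: "\<rho> u \<in> hom X A A" using restr_hom u by blast
  have rk: "\<rho> k \<in> hom X B B" using restr_hom k by blast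
  have rjk: "\<rho> (j \<cdot> k) \<in> hom X A A" using restr_hom jk by blast
  \<comment> \<open>Here \<open>x\<close> stands for either summand. Since
    \<open>x = \<rho> x \<cdot> j\<close>, the restrictions \<open>\<rho> (j \<cdot> k)\<close> and
    \<open>\<rho> x\<close> can be exchanged, after which \<open>comp_restr\<close> moves the former
    across \<open>j\<close>.\<close>
  have part: "\<rho> (j \<cdot> k) \<cdot> x = x \<cdot> \<rho> k \<and> x \<cdot> \<rho> k \<preceq> \<rho> u \<cdot> j"
    if x: "x \<in> hom X A B" and xj: "x \<preceq> j" and xk: "x \<cdot> k \<preceq> u" for x
  proof
    have rx: "\<rho> x \<in> hom X A A" using restr_hom x by blast
    have xx: "\<rho> x \<cdot> j = x" using xj by (simp add: leq_def)
    have "\<rho> (j \<cdot> k) \<cdot> x = \<rho> (j \<cdot> k) \<cdot> (\<rho> x \<cdot> j)" by (simp add: xx)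
    also have "\<dots> = \<rho> x \<cdot> (\<rho> (j \<cdot> k) \<cdot> j)"
      using comp_assoc[OF rjk rx j] comp_assoc[OF rx rjk j] restr_commute[OF jk x] by simp
    also have "\<dots> = \<rho> x \<cdot> (j \<cdot> \<rho> k)" using comp_restr[OF j k] by simp
    also have "\<dots> = x \<cdot> \<rho> k" using comp_assoc[OF rx j rk] xx by simp
    finally show "\<rho> (j \<cdot> k) \<cdot> x = x \<cdot> \<rho> k" .
    have xkh: "x \<cdot> k \<in> hom X A C" using x k comp_hom by blast
    have "\<rho> (x \<cdot> k) \<cdot> x \<preceq> \<rho> u \<cdot> x"
      using comp_mono_right[OF restr_mono[OF xk] restr_hom[OF xkh] x] .
    moreover have "\<rho> u \<cdot> x \<preceq> \<rho> u \<cdot> j" using comp_mono_left[OF xj x ru] .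
    ultimately show "x \<cdot> \<rho> k \<preceq> \<rho> u \<cdot> j" using comp_restr[OF x k] leq_trans by simp
  qed
  note pf = part[OF f fj fku] and pg = part[OF g gj gku]
  have "j \<cdot> \<rho> k = \<rho> (j \<cdot> k) \<cdot> (f \<squnion> g)" using comp_restr[OF j k] by (simp add: j_def)
  also have "\<dots> = f \<cdot> \<rho> k \<squnion> g \<cdot> \<rho> k" using comp_join[OF rjk f g fg] pf pg by simp
  finally have "j \<cdot> \<rho> k \<preceq> \<rho> u \<cdot> j"
    using join_least[OF comp_hom[OF f rk] comp_hom[OF g rk] interf_comp_right[OF fg f g rk rk]]
      pf pg by simp
  then have "j \<cdot> \<rho> k \<cdot> k \<preceq> \<rho> u \<cdot> j \<cdot> k"
    using comp_mono_right[OF _ comp_hom[OF j rk] k] by blast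
  moreover have "j \<cdot> \<rho> k \<cdot> k = j \<cdot> k" using comp_assoc[OF j rk k] restr_comp_self[OF k] by simp
  moreover have "\<rho> u \<cdot> j \<cdot> k = u" using comp_assoc[OF ru j k] ujk by (simp add: leq_def)
  ultimately have "j \<cdot> k \<preceq> u" by simp
  then show ?thesis using leq_antisym ujk unfolding j_def u_def by blast
qed

text \<open>Restrict the common join along \<open>\<rho> r\<close>: the summand \<open>f\<close>
  vanishes, which leaves \<open>r = \<rho> r \<cdot> r'\<close>. Exchanging the roles of
  \<open>r\<close> and \<open>r'\<close> then gives uniqueness by antisymmetry.\<close>

lemma rel_compl_leq:
  assumes "is_rel_compl X g f r" "is_rel_compl X g f r'"
  shows "r \<preceq> r'"
proof -
  obtain A B where r: "r \<in> hom X A B" and f: "f \<in> hom X A B"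
    using assms(1) by (auto simp: is_rel_compl_def parallel_def hom_def)
  have r': "r' \<in> hom X A B"
    using assms(2) f by (auto simp: is_rel_compl_def parallel_def hom_def)
  have rf: "r \<perp> f" and rf': "r' \<perp> f" and eq: "r \<squnion> f = r' \<squnion> f"
    using assms by (auto simp: is_rel_compl_def)
  have "r = \<rho> r \<cdot> (r' \<squnion> f)" using join_upper1[OF r f rf] eq by (simp add: leq_def)
  also have "\<dots> = \<rho> r \<cdot> r' \<squnion> \<rho> r \<cdot> f" using comp_join[OF restr_hom[OF r] r' f rf'] .
  also have "\<dots> = \<rho> r \<cdot> r'"
    using interf_restr_comp_zero[OF rf r f] join_zero_left[OF comp_hom[OF restr_hom[OF r] r']]
      join_commute by simp
  finally show ?thesis using leqI[OF r r'] by simp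
qed

lemma rel_compl_unique:
  "\<lbrakk>is_rel_compl X g f r; is_rel_compl X g f r'\<rbrakk> \<Longrightarrow> r = r'"
  by (simp add: leq_antisym rel_compl_leq)

end

section \<open>Complements of restriction idempotents\<close>

context classical_perp_restriction_category
begin

lemma is_rel_compl_rel_compl: "f \<preceq> g \<Longrightarrow> is_rel_compl X g f (rel_compl X g f)"
  unfolding rel_compl_def by (metis rel_compl_exists rel_compl_unique theI)

lemma compl_restr:
  assumes "f \<in> hom X A B"
  shows compl_hom: "compl X (\<rho> f) \<in> hom X A A"
    and compl_interf_restr: "compl X (\<rho> f) \<perp> \<rho> f"
    and compl_join: "compl X (\<rho> f) \<squnion> \<rho> f = \<iota> A"
    and restr_compl: "\<rho> (compl X (\<rho> f)) = compl X (\<rho> f)"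
proof -
  have A: "A \<in> Obj X" using hom_dom_obj assms by blast
  have rf: "\<rho> f \<in> hom X A A" using restr_hom assms by blast
  then have d: "Dom X (\<rho> f) = A" by (simp add: hom_def)
  have "\<rho> f \<preceq> \<iota> A" using restr_comp_leq[OF assms ident_hom[OF A]] ident_right[OF rf] by simp
  then have c: "is_rel_compl X (\<iota> A) (\<rho> f) (compl X (\<rho> f))"
    unfolding compl_def d by (rule is_rel_compl_rel_compl)
  show h: "compl X (\<rho> f) \<in> hom X A A"
    using c rf by (simp add: is_rel_compl_def parallel_def hom_def)
  show i: "compl X (\<rho> f) \<perp> \<rho> f" and j: "compl X (\<rho> f) \<squnion> \<rho> f = \<iota> A"
    using c by (simp_all add: is_rel_compl_def)
  \<comment> \<open>As a summand of \<open>\<iota> A\<close> the complement lies below the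
    identity.\<close>
  show "\<rho> (compl X (\<rho> f)) = compl X (\<rho> f)"
    using leq_ident_restr[OF _ A] join_upper1[OF h rf i] j by simp
qed

text \<open>The complement interferes with \<open>\<rho> f\<close>, hence with
  \<open>\<rho> f \<cdot> f\<close>, which is \<open>f\<close>. This makes the pair of
  \<open>f\<close> and its complement a legitimate argument of a wand.\<close>

lemma interf_compl:
  assumes "f \<in> hom X A B"
  shows "f \<perp> compl X (\<rho> f)"
proof -
  have "compl X (\<rho> f) \<cdot> \<iota> A \<perp> \<rho> f \<cdot> f"
    using interf_comp_right[OF compl_interf_restr[OF assms] compl_hom[OF assms] restr_hom[OF assms]
        ident_hom assms] hom_dom_obj[OF assms] .
  then show ?thesis
    using ident_right[OF compl_hom[OF assms]] restr_comp_self[OF assms] interf_sym by simp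
qed

lemma compl_comp_zero:
  assumes "f \<in> hom X A B"
  shows "compl X (\<rho> f) \<cdot> f = \<zero> A B"
  using interf_restr_comp_zero[OF interf_sym[OF interf_compl[OF assms]] compl_hom[OF assms] assms]
    restr_compl[OF assms] by simp

text \<open>Split \<open>g\<close> along the decomposition of the identity into the complement and
  \<open>\<rho> f\<close>; interference kills the second piece. Right distributivity of composition
  enters here.\<close>

lemma interf_compl_comp:
  assumes "f \<perp> g" "f \<in> hom X A B" "g \<in> hom X A C"
  shows "compl X (\<rho> f) \<cdot> g = g"
proof -
  have A: "A \<in> Obj X" using hom_dom_obj assms by blast
  note h = compl_hom[OF assms(2)] and r = restr_hom[OF assms(2)]
  have "g = (compl X (\<rho> f) \<squnion> \<rho> f) \<cdot> g"
    using compl_join[OF assms(2)] ident_left[OF assms(3)] by simp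
  also have "\<dots> = compl X (\<rho> f) \<cdot> g \<squnion> \<rho> f \<cdot> g"
    using join_comp[OF h r compl_interf_restr[OF assms(2)] assms(3)] .
  also have "\<dots> = compl X (\<rho> f) \<cdot> g"
    using interf_restr_comp_zero[OF assms] join_zero_left[OF comp_hom[OF h assms(3)]] join_commute
    by simp
  finally show ?thesis by simp
qed

text \<open>The counterpart of \<open>comp_restr\<close> for complements. Split \<open>h\<close>
  into its composites with \<open>compl X (\<rho> f)\<close> and \<open>\<rho> f\<close>: the
  complement of \<open>\<rho> (h \<cdot> f)\<close> fixes the first piece, which interferes with
  \<open>h \<cdot> f\<close>, and kills the second.\<close>

lemma compl_comp_commute:
  assumes h: "h \<in> hom X T S" and f: "f \<in> hom X S B"
  shows "compl X (\<rho> (h \<cdot> f)) \<cdot> h = h \<cdot> compl X (\<rho> f)"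
proof -
  have hf: "h \<cdot> f \<in> hom X T B" using comp_hom h f by blast
  have T: "T \<in> Obj X" using hom_dom_obj h by blast
  note c = compl_hom[OF f] and c' = compl_hom[OF hf]
  have hc: "h \<cdot> compl X (\<rho> f) \<in> hom X T S" and hr: "h \<cdot> \<rho> f \<in> hom X T S"
    using comp_hom[OF h] c restr_hom[OF f] by auto
  have ih: "h \<cdot> compl X (\<rho> f) \<perp> h \<cdot> \<rho> f"
    using interf_comp_left[OF compl_interf_restr[OF f] h c restr_hom[OF f]] .
  \<comment> \<open>By \<open>comp_restr\<close> the second piece is
    \<open>\<rho> (h \<cdot> f) \<cdot> h\<close>, so the complement meets its own
    idempotent.\<close>
  have z: "compl X (\<rho> (h \<cdot> f)) \<cdot> (h \<cdot> \<rho> f) = \<zero> T S"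
  proof -
    have rr: "\<rho> (h \<cdot> f) \<in> hom X T T" using restr_hom hf by blast
    have "compl X (\<rho> (h \<cdot> f)) \<cdot> \<rho> (h \<cdot> f) = \<zero> T T"
      using compl_comp_zero[OF rr] restr_restr[OF hf] by simp
    then show ?thesis
      using comp_assoc[OF c' rr h] comp_restr[OF h f] zero_comp[OF h T] by simp
  qed
  have i: "h \<cdot> f \<perp> h \<cdot> compl X (\<rho> f)" using interf_comp_left[OF interf_compl[OF f] h f c] .
  have "h = h \<cdot> (compl X (\<rho> f) \<squnion> \<rho> f)" using compl_join[OF f] ident_right[OF h] by simp
  also have "\<dots> = h \<cdot> compl X (\<rho> f) \<squnion> h \<cdot> \<rho> f"
    using comp_join[OF h c restr_hom[OF f] compl_interf_restr[OF f]] .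
  finally have "compl X (\<rho> (h \<cdot> f)) \<cdot> h
      = compl X (\<rho> (h \<cdot> f)) \<cdot> (h \<cdot> compl X (\<rho> f) \<squnion> h \<cdot> \<rho> f)" by simp
  also have "\<dots> = compl X (\<rho> (h \<cdot> f)) \<cdot> (h \<cdot> compl X (\<rho> f)) \<squnion> \<zero> T S"
    using comp_join[OF c' hc hr ih] z by simp
  also have "\<dots> = h \<cdot> compl X (\<rho> f)"
    using interf_compl_comp[OF i hf hc] join_zero_left[OF hc] join_commute by simp
  finally show ?thesis .
qed

text \<open>One half of a De Morgan law: the product of the two complements kills \<open>f\<close>
  and \<open>g\<close>, hence their join and its restriction, so it lies entirely under the
  complement of the join.\<close>

lemma compl_comp_compl_join:
  assumes f: "f \<in> hom X A B" and g: "g \<in> hom X A B" and fg: "f \<perp> g"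
  shows "compl X (\<rho> f) \<cdot> compl X (\<rho> g) \<cdot> compl X (\<rho> (f \<squnion> g)) = compl X (\<rho> f) \<cdot> compl X (\<rho> g)"
proof -
  note cf = compl_hom[OF f] and cg = compl_hom[OF g] and j = join_hom[OF f g fg]
  note cj = compl_hom[OF j]
  have A: "A \<in> Obj X" and B: "B \<in> Obj X" using f hom_dom_obj hom_cod_obj by auto
  define e where "e = compl X (\<rho> f) \<cdot> compl X (\<rho> g)"
  have e: "e \<in> hom X A A" unfolding e_def using comp_hom cf cg by blast
  \<comment> \<open>The complements commute as restriction idempotents, so either one can be placed
    next to the map it kills.\<close>
  have comm: "e = compl X (\<rho> g) \<cdot> compl X (\<rho> f)"
    unfolding e_def using restr_commute[OF cf cg] restr_compl f g by simp
  have "e \<cdot> f = \<zero> A B"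
    unfolding comm using comp_assoc[OF cg cf f] compl_comp_zero[OF f] comp_zero[OF cg B] by simp
  moreover have "e \<cdot> g = \<zero> A B"
    unfolding e_def using comp_assoc[OF cf cg g] compl_comp_zero[OF g] comp_zero[OF cf B] by simp
  ultimately have "e \<cdot> (f \<squnion> g) = \<zero> A B"
    using comp_join[OF e f g fg] join_zero_left[OF zero_hom[OF A B]] by simp
  then have z: "e \<cdot> \<rho> (f \<squnion> g) = \<zero> A A"
    using comp_restr[OF e j] restr_zero[OF A B] zero_comp[OF e A] by simp
  have "e = e \<cdot> (compl X (\<rho> (f \<squnion> g)) \<squnion> \<rho> (f \<squnion> g))"
    using compl_join[OF j] ident_right[OF e] by simp
  also have "\<dots> = e \<cdot> compl X (\<rho> (f \<squnion> g)) \<squnion> \<zero> A A"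
    using comp_join[OF e cj restr_hom[OF j] compl_interf_restr[OF j]] z by simp
  also have "\<dots> = e \<cdot> compl X (\<rho> (f \<squnion> g))"
    using join_zero_left[OF comp_hom[OF e cj]] join_commute by simp
  finally show ?thesis unfolding e_def by simp
qed

section \<open>The two translations are mutually inverse\<close>

lemma star_of_wand_apply:
  "f \<in> hom X S S \<Longrightarrow> star_of_wand X w f = w f (compl X (\<rho> f))"
  by (simp add: star_of_wand_def endos_def hom_def)

lemma wand_of_star_apply:
  "\<lbrakk>f \<in> hom X S S; g \<in> hom X S A; f \<perp> g\<rbrakk> \<Longrightarrow> wand_of_star X s f g = s f \<cdot> g"
  by (simp add: wand_of_star_def wand_dom_def endos_def hom_def)

text \<open>By \<open>wand_comp\<close> the left side is the wand of \<open>f\<close> and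
  \<open>compl X (\<rho> f) \<cdot> g\<close>, and \<open>g\<close> absorbs the complement. It
  converts products with a star into wands and back.\<close>

lemma wand_star_comp:
  assumes "kleene_wand X w" "f \<in> hom X S S" "g \<in> hom X S A" "f \<perp> g"
  shows "star_of_wand X w f \<cdot> g = w f g"
proof -
  interpret kleene_wand X w by fact
  show ?thesis
    using wand_comp[OF assms(2) compl_hom interf_compl assms(3)] assms
    by (simp add: star_of_wand_apply interf_compl_comp)
qed

lemma wand_of_star_of_wand:
  assumes "kleene_wand X w"
  shows "wand_of_star X (star_of_wand X w) = w"
proof (intro ext)
  fix f g
  show "wand_of_star X (star_of_wand X w) f g = w f g"
  proof (cases "(f, g) \<in> wand_dom X")
    case True
    then have "f \<in> hom X (Dom X f) (Dom X f)" "g \<in> hom X (Dom X f) (Cod X g)" "f \<perp> g"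
      by (auto simp: wand_dom_def endos_def hom_def)
    then show ?thesis using wand_star_comp[OF assms] wand_of_star_apply by metis
  next
    \<comment> \<open>Outside \<open>wand_dom\<close> both functions take the value
      \<open>undefined\<close>.\<close>
    case False
    then have "w f g = undefined"
      using kleene_wand.wand_extensional[OF assms] by (auto simp: extensional_def)
    with False show ?thesis by (simp add: wand_of_star_def)
  qed
qed

lemma star_comp_compl:
  assumes "kleene_upper_star X s" "f \<in> hom X S S"
  shows "s f \<cdot> compl X (\<rho> f) = s f"
proof -
  interpret kleene_upper_star X s by fact
  have S: "S \<in> Obj X" using hom_dom_obj assms by blast
  have "s (\<iota> S \<cdot> f) \<cdot> \<iota> S = \<iota> S \<cdot> s (f \<cdot> \<iota> S) \<cdot> compl X (\<rho> f)"
    using star_slide[OF assms(2) ident_hom[OF S]] .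
  then show ?thesis
    using ident_left[OF assms(2)] ident_right[OF assms(2)] star_hom[OF assms(2)]
      ident_left ident_right by metis
qed

lemma star_of_wand_of_star:
  assumes "kleene_upper_star X s"
  shows "star_of_wand X (wand_of_star X s) = s"
proof
  fix f
  show "star_of_wand X (wand_of_star X s) f = s f"
  proof (cases "f \<in> endos X")
    case True
    then have f: "f \<in> hom X (Dom X f) (Dom X f)" by (simp add: endos_def hom_def)
    show ?thesis
      using wand_of_star_apply[OF f compl_hom[OF f] interf_compl[OF f]] star_of_wand_apply[OF f]
        star_comp_compl[OF assms f] by simp
  next
    case False
    then show ?thesis
      using kleene_upper_star.star_extensional[OF assms]
      by (simp add: star_of_wand_def extensional_def)
  qed
qed

section \<open>From a wand to an upper-star\<close>

lemma kleene_upper_star_star_of_wand: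
  assumes "kleene_wand X w"
  shows "kleene_upper_star X (star_of_wand X w)"
proof -
  interpret kleene_wand X w by fact
  define s where "s = star_of_wand X w"
  note app = star_of_wand_apply[of _ _ w, folded s_def]
  note sw = wand_star_comp[OF assms, folded s_def]
  have hom: "s f \<in> hom X S S" if "f \<in> hom X S S" for f S
    using wand_hom[OF that compl_hom[OF that] interf_compl[OF that]] app[OF that] by simp
  \<comment> \<open>Push \<open>h\<close> into the second argument of the wand, commute it past the
    complement, and only then apply \<open>wand_slide\<close>.\<close>
  have slide: "s (h \<cdot> f) \<cdot> h = h \<cdot> s (f \<cdot> h) \<cdot> compl X (\<rho> f)"
    if f: "f \<in> hom X S T" and h: "h \<in> hom X T S" for f h S T
  proof -
    note c = compl_hom[OF f]
    have hf: "h \<cdot> f \<in> hom X T T" and fh: "f \<cdot> h \<in> hom X S S" using f h comp_hom by auto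
    note c' = compl_hom[OF hf]
    have i: "f \<cdot> h \<perp> compl X (\<rho> f)"
      using interf_comp_right[OF interf_compl[OF f] f c h ident_hom] hom_dom_obj[OF f]
        ident_right[OF c] by simp
    have "s (h \<cdot> f) \<cdot> h = w (h \<cdot> f) (compl X (\<rho> (h \<cdot> f)) \<cdot> h)"
      using app[OF hf] wand_comp[OF hf c' interf_compl[OF hf] h] by simp
    also have "\<dots> = w (h \<cdot> f) (h \<cdot> compl X (\<rho> f))" using compl_comp_commute[OF h f] by simp
    also have "\<dots> = h \<cdot> w (f \<cdot> h) (compl X (\<rho> f))"
      using wand_slide[OF f c h interf_compl[OF f]] .
    also have "\<dots> = h \<cdot> (s (f \<cdot> h) \<cdot> compl X (\<rho> f))" using sw[OF fh c i] by simp
    also have "\<dots> = h \<cdot> s (f \<cdot> h) \<cdot> compl X (\<rho> f)" using comp_assoc[OF h hom[OF fh] c] by simp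
    finally show ?thesis .
  qed
  have absorb: "s f \<cdot> compl X (\<rho> f) = s f" if "f \<in> hom X S S" for f S
    using sw[OF that compl_hom[OF that] interf_compl[OF that]] app[OF that] by simp
  \<comment> \<open>The wand law for joins yields the desired product \<open>t\<close> followed by
    the complement of \<open>\<rho> (f \<squnion> g)\<close>. It remains to see that
    \<open>t\<close> absorbs this complement.\<close>
  have join: "s (f \<squnion> g) = s (s f \<cdot> g) \<cdot> s f"
    if f: "f \<in> hom X S S" and g: "g \<in> hom X S S" and fg: "f \<perp> g" for f g S
  proof -
    note j = join_hom[OF f g fg] and sf = hom[OF f]
    note cf = compl_hom[OF f] and cg = compl_hom[OF g] and cj = compl_hom[OF j]
    have sfg: "s f \<cdot> g \<in> hom X S S" using comp_hom sf g by blast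
    note ssfg = hom[OF sfg]
    have gsf: "g \<cdot> s f \<in> hom X S S" using comp_hom sf g by blast
    define t where "t = s (s f \<cdot> g) \<cdot> s f"
    have t: "t \<in> hom X S S" unfolding t_def using comp_hom ssfg sf by blast
    have tf: "t \<cdot> compl X (\<rho> f) = t"
      unfolding t_def using comp_assoc[OF ssfg sf cf] absorb[OF f] by simp
    \<comment> \<open>Sliding \<open>s f\<close> around \<open>g\<close> exposes the complement of
      \<open>\<rho> g\<close> as the last factor of \<open>t\<close>.\<close>
    have tg: "t \<cdot> compl X (\<rho> g) = t"
    proof -
      define q where "q = s f \<cdot> s (g \<cdot> s f)"
      have q: "q \<in> hom X S S" unfolding q_def using comp_hom sf hom[OF gsf] by blast
      have "t = q \<cdot> compl X (\<rho> g)" unfolding t_def q_def using slide[OF g sf] .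
      moreover have "compl X (\<rho> g) \<cdot> compl X (\<rho> g) = compl X (\<rho> g)"
        using restr_idem[OF cg] restr_compl[OF g] by simp
      ultimately show ?thesis using comp_assoc[OF q cg cg] by simp
    qed
    have tj: "t \<cdot> compl X (\<rho> (f \<squnion> g)) = t"
    proof -
      have te: "t \<cdot> (compl X (\<rho> f) \<cdot> compl X (\<rho> g)) = t"
        using comp_assoc[OF t cf cg] tf tg by simp
      then show ?thesis
        using comp_assoc[OF t comp_hom[OF cf cg] cj] compl_comp_compl_join[OF f g fg] by simp
    qed
    have ij: "f \<squnion> g \<perp> compl X (\<rho> (f \<squnion> g))" using interf_compl[OF j] .
    have i: "f \<perp> compl X (\<rho> (f \<squnion> g))"
      using interf_down[OF ij join_upper1[OF f g fg] leq_refl[OF cj]] .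
    \<comment> \<open>This interference is what allows \<open>sw\<close> to rewrite the outer of the
      nested wands.\<close>
    note wi = wand_join_interf[OF f g cj fg ij]
    have "s (f \<squnion> g) = w (w f g) (w f (compl X (\<rho> (f \<squnion> g))))"
      using app[OF j] wand_join[OF f g cj fg ij] by simp
    also have "\<dots> = s (w f g) \<cdot> w f (compl X (\<rho> (f \<squnion> g)))"
      using sw[OF wand_hom[OF f g fg] wand_hom[OF f cj i] wi] by simp
    also have "\<dots> = s (s f \<cdot> g) \<cdot> (s f \<cdot> compl X (\<rho> (f \<squnion> g)))"
      using sw[OF f g fg] sw[OF f cj i] by simp
    also have "\<dots> = t \<cdot> compl X (\<rho> (f \<squnion> g))"
      unfolding t_def using comp_assoc[OF ssfg sf cj] by simp
    finally show ?thesis using tj unfolding t_def by simp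
  qed
  have "kleene_upper_star X s"
  proof
    show "s \<in> extensional (endos X)" unfolding s_def star_of_wand_def by simp
    show "compl X (\<rho> f) \<squnion> f \<cdot> s f = s f" if "f \<in> hom X S S" for f S
      using wand_unfold[OF that compl_hom[OF that] interf_compl[OF that]] app[OF that] by simp
  qed (fact hom slide join)+
  then show ?thesis unfolding s_def .
qed

section \<open>From an upper-star to a wand\<close>

lemma kleene_wand_wand_of_star:
  assumes "kleene_upper_star X s"
  shows "kleene_wand X (wand_of_star X s)"
proof -
  interpret kleene_upper_star X s by fact
  note app = wand_of_star_apply[of _ _ _ _ s]
  \<comment> \<open>Each summand lies below the join, and interference is inherited
    downwards.\<close>
  have join_perp: "f' \<perp> g" "f \<perp> g"
    if "f \<in> hom X S S" "f' \<in> hom X S S" "g \<in> hom X S A" "f \<perp> f'" "f \<squnion> f' \<perp> g" for f f' g S A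
    using interf_down[OF that(5)] join_upper1 join_upper2 leq_refl that by blast+
  show ?thesis
  proof
    show "case_prod (wand_of_star X s) \<in> extensional (wand_dom X)"
      by (simp add: wand_of_star_def)
  next
    fix f g S A
    assume f: "f \<in> hom X S S" and g: "g \<in> hom X S A" and fg: "f \<perp> g"
    note sf = star_hom[OF f] and c = compl_hom[OF f]
    show "wand_of_star X s f g \<in> hom X S A" using app[OF f g fg] comp_hom[OF sf g] by simp
    \<comment> \<open>The unfolding of \<open>s f\<close> is thus a join of interfering maps, so
      composing it with \<open>g\<close> distributes. The first summand becomes \<open>g\<close> by
      absorption.\<close>
    have i: "compl X (\<rho> f) \<perp> f \<cdot> s f"
      using interf_comp_right[OF interf_sym[OF interf_compl[OF f]] c f ident_hom sf]
        hom_dom_obj[OF f] ident_right[OF c] by simp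
    have "s f \<cdot> g = (compl X (\<rho> f) \<squnion> f \<cdot> s f) \<cdot> g" using star_unfold[OF f] by simp
    also have "\<dots> = compl X (\<rho> f) \<cdot> g \<squnion> f \<cdot> s f \<cdot> g"
      using join_comp[OF c comp_hom[OF f sf] i g] .
    also have "\<dots> = g \<squnion> f \<cdot> (s f \<cdot> g)"
      using interf_compl_comp[OF fg f g] comp_assoc[OF f sf g] by simp
    finally show "g \<squnion> f \<cdot> wand_of_star X s f g = wand_of_star X s f g"
      using app[OF f g fg] by simp
    fix h B
    assume h: "h \<in> hom X A B"
    have "f \<perp> g \<cdot> h"
      using interf_comp_right[OF fg f g ident_hom h] hom_dom_obj[OF f] ident_right[OF f] by simp
    then show "wand_of_star X s f g \<cdot> h = wand_of_star X s f (g \<cdot> h)"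
      using app[OF f g fg] app[OF f comp_hom[OF g h]] comp_assoc[OF sf g h] by simp
  next
    fix f g k S T A
    assume f: "f \<in> hom X S T" and g: "g \<in> hom X S A" and k: "k \<in> hom X T S" and fg: "f \<perp> g"
    have kf: "k \<cdot> f \<in> hom X T T" and kg: "k \<cdot> g \<in> hom X T A" and fk: "f \<cdot> k \<in> hom X S S"
      using f g k comp_hom by auto
    note c = compl_hom[OF f] and skf = star_hom[OF kf] and sfk = star_hom[OF fk]
    have i: "k \<cdot> f \<perp> k \<cdot> g" using interf_comp_left[OF fg k f g] .
    have i': "f \<cdot> k \<perp> g"
      using interf_comp_right[OF fg f g k ident_hom] hom_cod_obj[OF g] ident_right[OF g] by simp
    \<comment> \<open>The slide law for stars leaves a trailing complement of
      \<open>\<rho> f\<close>, which \<open>g\<close> absorbs because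
      \<open>f \<perp> g\<close>.\<close>
    have "s (k \<cdot> f) \<cdot> (k \<cdot> g) = k \<cdot> s (f \<cdot> k) \<cdot> compl X (\<rho> f) \<cdot> g"
      using comp_assoc[OF skf k g] star_slide[OF f k] by simp
    also have "\<dots> = k \<cdot> s (f \<cdot> k) \<cdot> g"
      using comp_assoc[OF comp_hom[OF k sfk] c g] interf_compl_comp[OF fg f g] by simp
    also have "\<dots> = k \<cdot> (s (f \<cdot> k) \<cdot> g)" using comp_assoc[OF k sfk g] .
    finally show "wand_of_star X s (k \<cdot> f) (k \<cdot> g) = k \<cdot> wand_of_star X s (f \<cdot> k) g"
      using app[OF kf kg i] app[OF fk g i'] by simp
  next
    fix f f' g S A
    assume f: "f \<in> hom X S S" and f': "f' \<in> hom X S S" and g: "g \<in> hom X S A"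
      and ff: "f \<perp> f'" and jg: "f \<squnion> f' \<perp> g"
    note p = join_perp[OF f f' g ff jg] and sf = star_hom[OF f]
    have a: "wand_of_star X s f f' = s f \<cdot> f'" and b: "wand_of_star X s f g = s f \<cdot> g"
      using app[OF f f' ff] app[OF f g p(2)] by auto
    have sff: "s f \<cdot> f' \<in> hom X S S" and sfg: "s f \<cdot> g \<in> hom X S A"
      using comp_hom sf f' g by auto
    have i: "s f \<cdot> f' \<perp> s f \<cdot> g" using interf_comp_left[OF p(1) sf f' g] .
    then show "wand_of_star X s f f' \<perp> wand_of_star X s f g" by (simp add: a b)
    show "wand_of_star X s (f \<squnion> f') g
        = wand_of_star X s (wand_of_star X s f f') (wand_of_star X s f g)"
      using app[OF join_hom[OF f f' ff] g jg] app[OF sff sfg i] star_join[OF f f' ff]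
        comp_assoc[OF star_hom[OF sff] sf g] by (simp add: a b)
  qed
qed

end

section \<open>The correspondence, for a fixed category and for all pairs\<close>

theorem theorem6p9:
  fixes X :: "('o, 'a, 'm) perp_cat_scheme"
  assumes "classical_perp_restriction_category X"
  shows "bij_betw (star_of_wand X) {w. kleene_wand X w} {s. kleene_upper_star X s} \<and>
    bij_betw (wand_of_star X) {s. kleene_upper_star X s} {w. kleene_wand X w} \<and>
    (\<forall>w. kleene_wand X w \<longrightarrow> wand_of_star X (star_of_wand X w) = w) \<and>
    (\<forall>s. kleene_upper_star X s \<longrightarrow> star_of_wand X (wand_of_star X s) = s) \<and>
    bij_betw (\<lambda>(Y, w). (Y, star_of_wand Y w))
      {(Y :: ('o, 'a, 'm) perp_cat_scheme, w). classical_perp_itegory Y w}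
      {(Y, s). classical_perp_restriction_category Y \<and> kleene_upper_star Y s}"
proof (intro conjI)
  note facts = classical_perp_restriction_category.wand_of_star_of_wand
    classical_perp_restriction_category.star_of_wand_of_star
    classical_perp_restriction_category.kleene_upper_star_star_of_wand
    classical_perp_restriction_category.kleene_wand_wand_of_star
  show "bij_betw (star_of_wand X) {w. kleene_wand X w} {s. kleene_upper_star X s}"
    by (rule bij_betw_byWitness[where f' = "wand_of_star X"]) (use facts[OF assms] in auto)
  show "bij_betw (wand_of_star X) {s. kleene_upper_star X s} {w. kleene_wand X w}"
    by (rule bij_betw_byWitness[where f' = "star_of_wand X"]) (use facts[OF assms] in auto)
  show "\<forall>w. kleene_wand X w \<longrightarrow> wand_of_star X (star_of_wand X w) = w"
    and "\<forall>s. kleene_upper_star X s \<longrightarrow> star_of_wand X (wand_of_star X s) = s"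
    using facts[OF assms] by auto
  \<comment> \<open>The category now varies with the pair, so \<open>facts\<close> is used at every
    classical \<open>Y\<close>. The definition of \<open>classical_perp_itegory\<close> splits into
    classicality of \<open>Y\<close> and the wand axioms.\<close>
  show "bij_betw (\<lambda>(Y, w). (Y, star_of_wand Y w))
      {(Y :: ('o, 'a, 'm) perp_cat_scheme, w). classical_perp_itegory Y w}
      {(Y, s). classical_perp_restriction_category Y \<and> kleene_upper_star Y s}"
    by (rule bij_betw_byWitness[where f' = "\<lambda>(Y, s). (Y, wand_of_star Y s)"])
      (use facts in \<open>auto simp: classical_perp_itegory_def\<close>)
qed

end
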